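(* Let $\mathbb{F}=\mathbb{R}$ or $\mathbb{C}$, let $V\subset\mathbb{F}^n$ be a subspace, and let $T\in GL(V)$. Then $T$ rotates the set of orientations $\mathcal{O}_V$ by the angle $\varphi=\arg(\det T)$; that is, under the identification of $\mathcal{O}_V$ with the unit circle of $\mathbb{F}$ determined by any reference basis $\beta_0$ of $V$, the action of $T$ on $\mathcal{O}_V$ is multiplication by $e^{\mathrm{i}\varphi}$.
   Context: Bases are ordered. $GL^+(V)=\{T\in GL(V):\det T>0\}$ (meaning $\det T$ is a positive real number). The set of orientations of $V$ is $\mathcal{O}_V=\{\text{bases }\beta\text{ of }V\}/\!\sim$, where $\beta_1\sim\beta_2$ if $\beta_2=S(\beta_1)$ for some $S\in GL^+(V)$. Once a basis $\beta_0$ of $V$ is fixed, $\mathcal{O}_V$ is identified with the unit circle of $\mathbb{F}$ (which is $\{\pm1\}$ if $\mathbb{F}=\mathbb{R}$, and $\{z\in\mathbb{C}:|z|=1\}$ if $\mathbb{F}=\mathbb{C}$) by associating to the orientation of $\beta=T_0(\beta_0)$, with $T_0\in GL(V)$, the number $e^{\mathrm{i}\arg(\det T_0)}$. The action of $T\in GL(V)$ on bases, $\beta\mapsto T(\beta)$, descends to an action on $\mathcal{O}_V$. If $\mathbb{F}=\mathbb{R}$, the "rotation" is by $\varphi=0$ ($T$ preserves orientations) or $\varphi=\pi$ ($T$ inverts them). *)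

theory Defs
  imports "HOL-Analysis.Analysis" "Jordan_Normal_Form.Determinant"
begin

text \<open>
  The scalar field is \<open>\<real>\<close> or \<open>\<complex>\<close>: the axioms force the type to be isomorphic, over \<open>\<real>\<close>, to one of
  these two. The embedding into \<open>\<complex>\<close> is what gives a meaning to \<open>arg\<close> of a scalar and lets the
  unit circle of the field be multiplied by \<open>e\<^sup>i\<^sup>\<phi>\<close>.
\<close>

class real_or_complex = real_field +
  fixes to_complex :: "'a \<Rightarrow> complex"
  assumes to_complex_add: "to_complex (x + y) = to_complex x + to_complex y"
    and to_complex_mult: "to_complex (x * y) = to_complex x * to_complex y"
    and to_complex_scaleR: "to_complex (r *\<^sub>R x) = r *\<^sub>R to_complex x"
    and range_to_complex: "range to_complex = \<real> \<or> range to_complex = UNIV"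

instantiation real :: real_or_complex
begin
definition to_complex_real :: "real \<Rightarrow> complex" where
  "to_complex_real = complex_of_real"
instance by standard (auto simp: to_complex_real_def Reals_def scaleR_conv_of_real)
end

instantiation complex :: real_or_complex
begin
definition to_complex_complex :: "complex \<Rightarrow> complex" where
  "to_complex_complex = (\<lambda>z. z)"
instance by standard (auto simp: to_complex_complex_def)
end

text \<open>\<open>{1, -1}\<close> for \<open>\<real>\<close>, and \<open>{z. cmod z = 1}\<close> for \<open>\<complex>\<close>.\<close>

definition unit_circle :: "'a::real_or_complex itself \<Rightarrow> complex set" where
  "unit_circle _ = {z \<in> range (to_complex :: 'a \<Rightarrow> complex). cmod z = 1}"

definition ordered_basis :: "('a::field ^ 'n) set \<Rightarrow> ('a ^ 'n) list \<Rightarrow> bool" where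
  "ordered_basis V \<beta> \<longleftrightarrow> distinct \<beta> \<and> vec.independent (set \<beta>) \<and> vec.span (set \<beta>) = V"

text \<open>
  Elements of \<open>GL(V)\<close> are represented by functions on the ambient space whose values outside
  \<open>V\<close> are irrelevant.
\<close>

definition GL :: "('a::field ^ 'n) set \<Rightarrow> ('a ^ 'n \<Rightarrow> 'a ^ 'n) set" where
  "GL V = {T. (\<forall>u\<in>V. \<forall>v\<in>V. T (u + v) = T u + T v) \<and>
              (\<forall>c. \<forall>v\<in>V. T (c *s v) = c *s T v) \<and> bij_betw T V V}"

definition matrix_wrt :: "('a::field ^ 'n) list \<Rightarrow> ('a ^ 'n \<Rightarrow> 'a ^ 'n) \<Rightarrow> 'a mat" where
  "matrix_wrt \<beta> T = Matrix.mat (length \<beta>) (length \<beta>)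
     (\<lambda>(i, j). vec.representation (set \<beta>) (T (\<beta> ! j)) (\<beta> ! i))"

text \<open>The determinant of \<open>T\<close> as an operator on \<open>V\<close>; the value does not depend on the basis.\<close>

definition det_on :: "('a::field ^ 'n) set \<Rightarrow> ('a ^ 'n \<Rightarrow> 'a ^ 'n) \<Rightarrow> 'a" where
  "det_on V T = Determinant.det (matrix_wrt (SOME \<beta>. ordered_basis V \<beta>) T)"

definition GL_pos :: "('a::real_field ^ 'n) set \<Rightarrow> ('a ^ 'n \<Rightarrow> 'a ^ 'n) set" where
  "GL_pos V = {T \<in> GL V. \<exists>r>0. det_on V T = of_real r}"

definition orientation_rel :: "('a::real_field ^ 'n) set \<Rightarrow> ('a ^ 'n) list rel" where
  "orientation_rel V = {(\<beta>1, \<beta>2). ordered_basis V \<beta>1 \<and> ordered_basis V \<beta>2 \<and>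
                                  (\<exists>S\<in>GL_pos V. \<beta>2 = map S \<beta>1)}"

definition orientations :: "('a::real_field ^ 'n) set \<Rightarrow> ('a ^ 'n) list set set" where
  "orientations V = {\<beta>. ordered_basis V \<beta>} // orientation_rel V"

definition orientation_of :: "('a::real_field ^ 'n) set \<Rightarrow> ('a ^ 'n) list \<Rightarrow> ('a ^ 'n) list set" where
  "orientation_of V \<beta> = orientation_rel V `` {\<beta>}"

definition act :: "('a ^ 'n \<Rightarrow> 'a ^ 'n) \<Rightarrow> ('a ^ 'n) list set \<Rightarrow> ('a ^ 'n) list set" where
  "act T \<omega> = map T ` \<omega>"

text \<open>\<open>Arg\<close> takes values in \<open>(-\<pi>, \<pi>]\<close>, so over \<open>\<real>\<close> the angle is \<open>0\<close> or \<open>\<pi>\<close>.\<close>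

definition det_angle :: "('a::real_or_complex ^ 'n) set \<Rightarrow> ('a ^ 'n \<Rightarrow> 'a ^ 'n) \<Rightarrow> real" where
  "det_angle V T = Arg (to_complex (det_on V T))"

definition orientation_number ::
  "('a::real_or_complex ^ 'n) set \<Rightarrow> ('a ^ 'n) list \<Rightarrow> ('a ^ 'n) list set \<Rightarrow> complex" where
  "orientation_number V \<beta>0 \<omega> =
     (THE z. \<exists>T0\<in>GL V. \<omega> = orientation_of V (map T0 \<beta>0) \<and> z = cis (det_angle V T0))"

end

theory Submission
  imports Defs
begin

text \<open>
  By multiplicativity of the determinant, \<open>T \<mapsto> e\<^sup>i\<^sup>\<phi>\<close> with \<open>\<phi> = arg (det T)\<close> is a group homomorphism
  from \<open>GL(V)\<close> to the unit circle of the field, and its kernel is exactly \<open>GL\<^sup>+(V)\<close>: a nonzero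
  scalar is a positive real number iff its sign \<open>z / |z|\<close> is \<open>1\<close>
  (\<open>cis_det_angle_comp\<close>, \<open>GL_pos_iff\<close>).

  On the other hand \<open>GL(V)\<close> acts simply transitively on ordered bases (\<open>ordered_basis_map\<close>,
  \<open>GL_between_bases\<close>, \<open>GL_eq_on_basis\<close>). So a reference basis \<open>\<beta>0\<close> identifies bases with elements
  of \<open>GL(V)\<close>, and orientations with cosets of \<open>GL\<^sup>+(V)\<close>, that is, with the fibres of the
  homomorphism (\<open>orientation_of_map\<close>). Hence the number attached to an orientation is well defined
  and determines the orientation, every number of the unit circle arises as soon as
  \<open>det\<close> takes every nonzero value, which it does if \<open>V \<noteq> {0}\<close> (\<open>det_on_surj\<close>), and applying \<open>T\<close>
  to \<open>S(\<beta>0)\<close> gives \<open>(T \<circ> S)(\<beta>0)\<close>, whose number is the product of the numbers of \<open>T\<close> and \<open>S\<close>.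

  The determinant on \<open>V\<close> is taken in one chosen basis of \<open>V\<close>, the same for all of \<open>GL(V)\<close>. So its
  multiplicativity is that of the determinant of matrices (\<open>matrix_wrt_comp\<close>).
\<close>

section \<open>The group \<open>GL(V)\<close>\<close>

lemma GL_mem: "T \<in> GL V \<Longrightarrow> v \<in> V \<Longrightarrow> T v \<in> V"
  by (auto simp: GL_def bij_betw_def)

text \<open>
  Elements of \<open>GL(V)\<close> are linear only on \<open>V\<close>, so the library facts on linear maps do not apply to
  them; this replaces \<open>linear_sum\<close>.
\<close>

lemma GL_sum:
  assumes "vec.subspace V" "T \<in> GL V" "\<And>a. a \<in> A \<Longrightarrow> f a \<in> V"
  shows "T (sum f A) = (\<Sum>a\<in>A. T (f a))"
proof -
  have "0 \<in> V" using assms(1) by (rule vec.subspace_0)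
  \<comment> \<open>Additivity and homogeneity on \<open>V\<close> give \<open>T 0 = 0\<close>, which the empty sum needs.\<close>
  then have "T (0 *s 0) = 0 *s T 0" using assms(2) by (simp only: GL_def mem_Collect_eq)
  then have T0: "T 0 = 0" by simp
  show ?thesis
    using assms(3)
  proof (induction A rule: infinite_finite_induct)
    case (insert a A)
    have "sum f A \<in> V" using insert.prems by (intro vec.subspace_sum[OF assms(1)]) auto
    then have "T (f a + sum f A) = T (f a) + T (sum f A)"
      using insert.prems assms(2) by (simp add: GL_def)
    then show ?case using insert by simp
  qed (simp_all add: T0)
qed

lemma GL_id: "id \<in> GL V"
  by (simp add: GL_def)

lemma GL_comp: "S \<in> GL V \<Longrightarrow> T \<in> GL V \<Longrightarrow> S \<circ> T \<in> GL V"
  unfolding GL_def using bij_betw_trans[of T V V S V] by (auto dest: bij_betwE)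

lemma GL_inverse:
  assumes V: "vec.subspace V" and T: "T \<in> GL V"
  obtains S where "S \<in> GL V" "\<forall>v\<in>V. S (T v) = v" "\<forall>v\<in>V. T (S v) = v"
proof -
  define S where "S = inv_into V T"
  have bij: "bij_betw T V V" and add: "\<And>u v. u \<in> V \<Longrightarrow> v \<in> V \<Longrightarrow> T (u + v) = T u + T v"
    and scale: "\<And>c v. v \<in> V \<Longrightarrow> T (c *s v) = c *s T v"
    using T by (auto simp: GL_def)
  have bijS: "bij_betw S V V" unfolding S_def by (rule bij_betw_inv_into[OF bij])
  have mem: "S v \<in> V" if "v \<in> V" for v using bijS that by (auto simp: bij_betw_def)
  have TS: "T (S v) = v" if "v \<in> V" for v
    unfolding S_def using bij that by (simp add: bij_betw_inv_into_right)
  have ST: "S (T v) = v" if "v \<in> V" for v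
    unfolding S_def using bij that by (simp add: bij_betw_inv_into_left)
  have "S (u + v) = S u + S v" if "u \<in> V" "v \<in> V" for u v
    using ST[of "S u + S v"] add[of "S u" "S v"] that mem TS V by (simp add: vec.subspace_add)
  moreover have "S (c *s v) = c *s S v" if "v \<in> V" for c v
    using ST[of "c *s S v"] scale[of "S v" c] that mem TS V by (simp add: vec.subspace_scale)
  ultimately have "S \<in> GL V" using bijS by (simp add: GL_def)
  then show thesis using that[of S] ST TS by simp
qed

section \<open>Ordered bases\<close>

lemma ordered_basis_nth:
  assumes "ordered_basis V \<beta>" "i < length \<beta>"
  shows "\<beta> ! i \<in> V"
  using assms vec.span_base[of "\<beta> ! i" "set \<beta>"] by (simp add: ordered_basis_def)

lemma ordered_basis_length:
  assumes "ordered_basis V \<beta>"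
  shows "length \<beta> = vec.dim V"
proof -
  have dis: "distinct \<beta>" and ind: "vec.independent (set \<beta>)" and sp: "vec.span (set \<beta>) = V"
    using assms by (simp_all add: ordered_basis_def)
  have "length \<beta> = vec.dim (vec.span (set \<beta>))"
    by (simp only: vec.dim_span_eq_card_independent[OF ind] distinct_card[OF dis])
  then show ?thesis by (simp only: sp)
qed

lemma ordered_basis_exists:
  assumes "vec.subspace V"
  obtains \<beta> where "ordered_basis V \<beta>"
proof -
  obtain B where B: "B \<subseteq> V" "vec.independent B" "V \<subseteq> vec.span B"
    by (rule vec.basis_exists)
  have "vec.span B = V" using vec.span_minimal[OF B(1) assms] B(3) by (rule antisym)
  moreover obtain \<beta> where "set \<beta> = B" "distinct \<beta>"
    using finite_distinct_list[OF vec.finiteI_independent[OF B(2)]] by blast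
  ultimately show thesis using that[of \<beta>] B(2) by (simp add: ordered_basis_def)
qed

lemma ordered_basis_expansion:
  assumes "ordered_basis V \<beta>" "v \<in> V"
  shows "v = (\<Sum>i<length \<beta>. vec.representation (set \<beta>) v (\<beta> ! i) *s \<beta> ! i)"
proof -
  have "v = (\<Sum>b\<in>set \<beta>. vec.representation (set \<beta>) v b *s b)"
    using assms vec.sum_representation_eq[of "set \<beta>" v "set \<beta>"] by (simp add: ordered_basis_def)
  also have "\<dots> = (\<Sum>i<length \<beta>. vec.representation (set \<beta>) v (\<beta> ! i) *s \<beta> ! i)"
    by (rule sum.reindex_bij_betw[symmetric, OF bij_betw_nth])
       (use assms in \<open>auto simp: ordered_basis_def\<close>)
  finally show ?thesis .
qed

text \<open>
  The action of \<open>GL(V)\<close> on bases is free, elements of \<open>GL(V)\<close> being compared on \<open>V\<close> only.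
\<close>

lemma GL_eq_on_basis:
  assumes V: "vec.subspace V" and ST: "S \<in> GL V" "T \<in> GL V"
    and \<beta>: "ordered_basis V \<beta>" and eq: "map S \<beta> = map T \<beta>" and v: "v \<in> V"
  shows "S v = T v"
proof -
  have lin: "R v = (\<Sum>i<length \<beta>. vec.representation (set \<beta>) v (\<beta> ! i) *s R (\<beta> ! i))"
    if R: "R \<in> GL V" for R
  proof -
    have "R (\<Sum>i<length \<beta>. vec.representation (set \<beta>) v (\<beta> ! i) *s \<beta> ! i) =
        (\<Sum>i<length \<beta>. R (vec.representation (set \<beta>) v (\<beta> ! i) *s \<beta> ! i))"
      by (rule GL_sum[OF V R]) (simp add: V \<beta> ordered_basis_nth vec.subspace_scale)
    then show ?thesis
      using R ordered_basis_expansion[OF \<beta> v, symmetric] ordered_basis_nth[OF \<beta>]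
      by (simp add: GL_def)
  qed
  show ?thesis
    unfolding lin[OF ST(1)] lin[OF ST(2)]
    by (rule sum.cong) (use eq in \<open>auto simp: list_eq_iff_nth_eq\<close>)
qed

text \<open>
  The action of \<open>GL(V)\<close> on bases is transitive: \<open>\<beta>!i \<mapsto> \<gamma>!i\<close> extends to a linear map of the whole
  space, which is injective on the span of \<open>\<beta>\<close> because it sends \<open>\<beta>\<close> injectively to the independent
  set \<open>\<gamma>\<close>.
\<close>

lemma GL_between_bases:
  assumes \<beta>: "ordered_basis V \<beta>" and \<gamma>: "ordered_basis V \<gamma>"
  obtains T where "T \<in> GL V" "map T \<beta> = \<gamma>"
proof -
  have len: "length \<beta> = length \<gamma>"
    using ordered_basis_length[OF \<beta>] ordered_basis_length[OF \<gamma>] by simp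
  define f where "f = (\<lambda>b. the (map_of (zip \<beta> \<gamma>) b))"
  have f: "f (\<beta> ! i) = \<gamma> ! i" if "i < length \<beta>" for i
    using \<beta> len that by (simp add: f_def ordered_basis_def map_of_zip_nth)
  have ind: "vec.independent (set \<beta>)" using \<beta> by (simp add: ordered_basis_def)
  obtain T where lin: "Vector_Spaces.linear (*s) (*s) T" and Tf: "\<forall>b\<in>set \<beta>. T b = f b"
    using vec.linear_independent_extend[OF ind] by blast
  interpret T: Vector_Spaces.linear "(*s)" "(*s)" T by (rule lin)
  have map: "map T \<beta> = \<gamma>" using Tf f len by (simp add: list_eq_iff_nth_eq)
  then have img: "T ` set \<beta> = set \<gamma>" by (metis set_map)
  have "inj_on T (set \<beta>)" using map \<gamma> by (metis distinct_map ordered_basis_def)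
  then have "inj_on T V"
    using T.inj_on_span_independent_image[of "set \<beta>"] img \<beta> \<gamma> by (simp add: ordered_basis_def)
  moreover have "T ` V = V"
    using T.span_image[of "set \<beta>"] img \<beta> \<gamma> by (simp add: ordered_basis_def)
  ultimately have "T \<in> GL V" by (simp add: GL_def T.add T.scale bij_betw_def)
  then show thesis using that map by blast
qed

text \<open>
  On \<open>V\<close> the function \<open>T\<close> agrees with a linear map \<open>L\<close> of the whole space, and an injective
  linear map carries independent sets to independent sets and spans to spans.
\<close>

lemma ordered_basis_map:
  assumes V: "vec.subspace V" and T: "T \<in> GL V" and \<beta>: "ordered_basis V \<beta>"
  shows "ordered_basis V (map T \<beta>)"
proof -
  have ind: "vec.independent (set \<beta>)" and sp: "vec.span (set \<beta>) = V" and dis: "distinct \<beta>"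
    using \<beta> by (auto simp: ordered_basis_def)
  obtain L where lin: "Vector_Spaces.linear (*s) (*s) L" and Lb: "\<forall>b\<in>set \<beta>. L b = T b"
    using vec.linear_independent_extend[OF ind] by blast
  interpret L: Vector_Spaces.linear "(*s)" "(*s)" L by (rule lin)
  have "L v = T v" if v: "v \<in> V" for v
  proof -
    let ?c = "\<lambda>i. vec.representation (set \<beta>) v (\<beta> ! i)"
    have "T (\<Sum>i<length \<beta>. ?c i *s \<beta> ! i) = (\<Sum>i<length \<beta>. T (?c i *s \<beta> ! i))"
      by (rule GL_sum[OF V T]) (simp add: V \<beta> ordered_basis_nth vec.subspace_scale)
    also have "\<dots> = (\<Sum>i<length \<beta>. ?c i *s L (\<beta> ! i))"
      using T Lb ordered_basis_nth[OF \<beta>] by (simp add: GL_def)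
    also have "\<dots> = L (\<Sum>i<length \<beta>. ?c i *s \<beta> ! i)" by (simp add: L.sum L.scale)
    finally show ?thesis using ordered_basis_expansion[OF \<beta> v] by simp
  qed
  then have bij: "bij_betw L V V" using T bij_betw_cong[of V L T V] by (simp add: GL_def)
  have map: "map T \<beta> = map L \<beta>" using Lb by simp
  have "inj_on L (vec.span (set \<beta>))" using bij sp by (simp add: bij_betw_def)
  then have "vec.independent (L ` set \<beta>)" "inj_on L (set \<beta>)"
    using L.independent_injective_image[OF ind] inj_on_subset vec.span_superset by blast+
  moreover have "vec.span (L ` set \<beta>) = V"
    using L.span_image[of "set \<beta>"] sp bij by (simp add: bij_betw_def)
  ultimately show ?thesis by (simp add: map ordered_basis_def distinct_map dis)
qed

section \<open>The determinant on \<open>V\<close>\<close>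

lemma matrix_wrt_carrier: "matrix_wrt \<beta> T \<in> carrier_mat (length \<beta>) (length \<beta>)"
  by (simp add: matrix_wrt_def)

lemma matrix_wrt_comp:
  assumes V: "vec.subspace V" and S: "S \<in> GL V" and T: "T \<in> GL V" and \<beta>: "ordered_basis V \<beta>"
  shows "matrix_wrt \<beta> (S \<circ> T) = matrix_wrt \<beta> S * matrix_wrt \<beta> T"
proof (rule eq_matI)
  fix i j
  assume "i < dim_row (matrix_wrt \<beta> S * matrix_wrt \<beta> T)"
    and "j < dim_col (matrix_wrt \<beta> S * matrix_wrt \<beta> T)"
  then have ij: "i < length \<beta>" "j < length \<beta>" by (simp_all add: matrix_wrt_def)
  let ?r = "vec.representation (set \<beta>)"
  let ?v = "T (\<beta> ! j)"
  have ind: "vec.independent (set \<beta>)" and sp: "vec.span (set \<beta>) = V"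
    using \<beta> by (auto simp: ordered_basis_def)
  have v: "?v \<in> V" using GL_mem[OF T] ordered_basis_nth[OF \<beta>] ij by simp
  have SV: "S (\<beta> ! k) \<in> V" if "k < length \<beta>" for k
    using GL_mem[OF S] ordered_basis_nth[OF \<beta>] that by simp
  have "S ?v = S (\<Sum>k<length \<beta>. ?r ?v (\<beta> ! k) *s \<beta> ! k)"
    using ordered_basis_expansion[OF \<beta> v] by simp
  also have "\<dots> = (\<Sum>k<length \<beta>. S (?r ?v (\<beta> ! k) *s \<beta> ! k))"
    by (rule GL_sum[OF V S]) (simp add: V \<beta> ordered_basis_nth vec.subspace_scale)
  also have "\<dots> = (\<Sum>k<length \<beta>. ?r ?v (\<beta> ! k) *s S (\<beta> ! k))"
    using S ordered_basis_nth[OF \<beta>] by (simp add: GL_def)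
  finally have "?r (S ?v) = (\<lambda>b. \<Sum>k<length \<beta>. ?r (?r ?v (\<beta> ! k) *s S (\<beta> ! k)) b)"
    using vec.representation_sum[OF ind, of "{..<length \<beta>}" "\<lambda>k. ?r ?v (\<beta> ! k) *s S (\<beta> ! k)"]
    by (simp add: sp V SV vec.subspace_scale)
  then have "?r (S ?v) (\<beta> ! i) = (\<Sum>k<length \<beta>. ?r ?v (\<beta> ! k) * ?r (S (\<beta> ! k)) (\<beta> ! i))"
    using SV by (simp add: vec.representation_scale[OF ind] sp)
  then show "matrix_wrt \<beta> (S \<circ> T) $$ (i, j) = (matrix_wrt \<beta> S * matrix_wrt \<beta> T) $$ (i, j)"
    using ij by (simp add: matrix_wrt_def scalar_prod_def atLeast0LessThan mult.commute)
qed (simp_all add: matrix_wrt_def)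

lemma matrix_wrt_id:
  fixes \<beta> :: "('a::field ^ 'n) list"
  assumes "ordered_basis V \<beta>"
  shows "matrix_wrt \<beta> id = 1\<^sub>m (length \<beta>)"
proof (rule eq_matI)
  fix i j
  assume "i < dim_row (1\<^sub>m (length \<beta>) :: 'a mat)" "j < dim_col (1\<^sub>m (length \<beta>) :: 'a mat)"
  then have ij: "i < length \<beta>" "j < length \<beta>" by simp_all
  have "vec.independent (set \<beta>)" "distinct \<beta>" using assms by (simp_all add: ordered_basis_def)
  then show "matrix_wrt \<beta> id $$ (i, j) = 1\<^sub>m (length \<beta>) $$ (i, j)"
    using ij by (simp add: matrix_wrt_def vec.representation_basis nth_eq_iff_index_eq)
qed (simp_all add: matrix_wrt_def)

lemma matrix_wrt_cong:
  assumes "ordered_basis V \<beta>" "\<And>v. v \<in> V \<Longrightarrow> S v = T v"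
  shows "matrix_wrt \<beta> S = matrix_wrt \<beta> T"
  using ordered_basis_nth[OF assms(1)] assms(2) by (intro eq_matI) (simp_all add: matrix_wrt_def)

lemma some_ordered_basis:
  assumes "vec.subspace V"
  shows "ordered_basis V (SOME \<beta>. ordered_basis V \<beta>)"
  by (rule ordered_basis_exists[OF assms]) (rule someI)

lemma det_on_cong:
  assumes "vec.subspace V" "\<And>v. v \<in> V \<Longrightarrow> S v = T v"
  shows "det_on V S = det_on V T"
  unfolding det_on_def
  by (simp only: matrix_wrt_cong[OF some_ordered_basis[OF assms(1)] assms(2)])

lemma det_on_id:
  assumes "vec.subspace V"
  shows "det_on V id = 1"
  unfolding det_on_def by (simp add: matrix_wrt_id[OF some_ordered_basis[OF assms]])

lemma det_on_comp:
  assumes "vec.subspace V" "S \<in> GL V" "T \<in> GL V"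
  shows "det_on V (S \<circ> T) = det_on V S * det_on V T"
  unfolding det_on_def matrix_wrt_comp[OF assms some_ordered_basis[OF assms(1)]]
  by (rule det_mult[OF matrix_wrt_carrier matrix_wrt_carrier])

lemma det_on_nonzero:
  assumes V: "vec.subspace V" and T: "T \<in> GL V"
  shows "det_on V T \<noteq> 0"
proof -
  obtain S where S: "S \<in> GL V" "\<forall>v\<in>V. S (T v) = v" "\<forall>v\<in>V. T (S v) = v"
    by (rule GL_inverse[OF V T])
  have "det_on V S * det_on V T = det_on V (S \<circ> T)" by (rule det_on_comp[OF V S(1) T, symmetric])
  also have "\<dots> = det_on V id" by (rule det_on_cong[OF V]) (simp add: S(2))
  finally show ?thesis by (auto simp: det_on_id[OF V])
qed

text \<open>
  The map that scales the first basis vector by \<open>c\<close> and fixes the others has determinant \<open>c\<close>. This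
  fails for \<open>V = {0}\<close>, where the only determinant is \<open>1\<close>.
\<close>

lemma det_on_surj:
  assumes V: "vec.subspace V" and "V \<noteq> {0}" and c: "c \<noteq> 0"
  obtains T where "T \<in> GL V" "det_on V T = c"
proof -
  define \<beta> where "\<beta> = (SOME \<beta>. ordered_basis V \<beta>)"
  have \<beta>: "ordered_basis V \<beta>" unfolding \<beta>_def by (rule some_ordered_basis[OF V])
  have ind: "vec.independent (set \<beta>)" and sp: "vec.span (set \<beta>) = V" and dis: "distinct \<beta>"
    using \<beta> by (auto simp: ordered_basis_def)
  have len: "0 < length \<beta>" using sp \<open>V \<noteq> {0}\<close> by auto
  define b where "b = \<beta> ! 0"
  have b: "b \<in> set \<beta>" "b \<in> V" using len ordered_basis_nth[OF \<beta>] by (auto simp: b_def)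
  define r where "r = (\<lambda>v. vec.representation (set \<beta>) v b)"
  have r_add: "r (u + v) = r u + r v" if "u \<in> V" "v \<in> V" for u v
    using that by (simp add: r_def vec.representation_add[OF ind] sp)
  have r_scale: "r (a *s v) = a * r v" if "v \<in> V" for a v
    using that by (simp add: r_def vec.representation_scale[OF ind] sp)
  have r_b: "r b = 1" by (simp add: r_def vec.representation_basis[OF ind b(1)])
  \<comment> \<open>\<open>r v\<close> is the coordinate of \<open>v\<close> along \<open>b\<close>, so \<open>D a\<close> multiplies that coordinate by \<open>a\<close>. Written
      this way for all \<open>a\<close>, the inverse of \<open>D c\<close> is \<open>D (inverse c)\<close>.\<close>
  define D where "D = (\<lambda>a v. v + ((a - 1) * r v) *s b)"
  have D_mem: "D a v \<in> V" if "v \<in> V" for a v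
    using that b(2) V by (simp add: D_def vec.subspace_add vec.subspace_scale)
  have D_inv: "D a' (D a v) = v" if "v \<in> V" "a' * a = 1" for a a' v
  proof -
    have "r (D a v) = r v + (a - 1) * r v"
      using that(1) b(2) V r_b by (simp add: D_def r_add r_scale vec.subspace_scale)
    then have rD: "r (D a v) = a * r v" by (simp add: algebra_simps)
    have "D a' (D a v) = v + ((a - 1) * r v + (a' - 1) * (a * r v)) *s b"
      using rD by (simp add: D_def vec.scale_left_distrib)
    also have "(a - 1) * r v + (a' - 1) * (a * r v) = (a' * a - 1) * r v"
      by (simp add: algebra_simps)
    finally show ?thesis using that(2) by simp
  qed
  have "bij_betw (D c) V V"
    by (rule bij_betw_byWitness[where f' = "D (inverse c)"]) (use c D_inv D_mem in auto)
  then have GL: "D c \<in> GL V"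
    by (simp add: GL_def D_def r_add r_scale vec.scale_left_distrib vec.scale_right_distrib
        algebra_simps)
  have "matrix_wrt \<beta> (D c) = multrow_mat (length \<beta>) 0 c"
  proof (rule eq_matI)
    fix i j
    assume "i < dim_row (multrow_mat (length \<beta>) 0 c)" "j < dim_col (multrow_mat (length \<beta>) 0 c)"
    then have ij: "i < length \<beta>" "j < length \<beta>" by simp_all
    have idx: "\<beta> ! k = \<beta> ! l \<longleftrightarrow> k = l" if "k < length \<beta>" "l < length \<beta>" for k l
      using dis that by (simp add: nth_eq_iff_index_eq)
    have "D c (\<beta> ! j) = (if j = 0 then c else 1) *s \<beta> ! j"
      using ij idx[of 0 j] len
      by (auto simp: D_def r_def b_def vec.representation_basis[OF ind] vec.scale_left_diff_distrib)
    then show "matrix_wrt \<beta> (D c) $$ (i, j) = multrow_mat (length \<beta>) 0 c $$ (i, j)"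
      using ij idx[of i j] vec.span_base[of "\<beta> ! j" "set \<beta>"]
      by (simp add: matrix_wrt_def vec.representation_scale[OF ind] vec.representation_basis[OF ind])
  qed (simp_all add: matrix_wrt_def)
  then have "det_on V (D c) = c"
    using det_multrow_mat[OF len] by (simp add: det_on_def \<beta>_def)
  then show thesis using that GL by blast
qed

section \<open>The angle of the determinant\<close>

lemma to_complex_0: "to_complex (0 :: 'a::real_or_complex) = 0"
  using to_complex_add[of "0 :: 'a" 0] by simp

text \<open>
  Multiplicativity alone would allow \<open>to_complex 1 = 0\<close>; the range axiom excludes it, since \<open>1\<close> is
  a value.
\<close>

lemma to_complex_1: "to_complex (1 :: 'a::real_or_complex) = 1"
proof -
  have "(1 :: complex) \<in> range (to_complex :: 'a \<Rightarrow> complex)"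
    using range_to_complex[where 'a = 'a] by auto
  then obtain x :: 'a where x: "to_complex x = 1" by (metis imageE)
  then show ?thesis using to_complex_mult[of x 1] by simp
qed

lemma to_complex_of_real: "to_complex (of_real r :: 'a::real_or_complex) = of_real r"
  using to_complex_scaleR[of r "1 :: 'a"] by (simp add: of_real_def to_complex_1)

lemma to_complex_inj: "inj (to_complex :: 'a::real_or_complex \<Rightarrow> complex)"
proof (rule injI, rule ccontr)
  fix x y :: 'a
  assume eq: "to_complex x = to_complex y" and "x \<noteq> y"
  have "to_complex (x - y) + to_complex y = to_complex x" using to_complex_add[of "x - y" y] by simp
  then have "to_complex (x - y) = 0" using eq by simp
  then have "to_complex ((x - y) * inverse (x - y)) = 0" by (simp only: to_complex_mult mult_zero_left)
  then show False using \<open>x \<noteq> y\<close> by (simp add: to_complex_1)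
qed

text \<open>
  Replacing \<open>cis \<circ> Arg\<close> by \<open>sgn\<close> removes the branch cut of \<open>Arg\<close> and leaves a multiplicative
  function. The two differ at \<open>0\<close>, hence the use of invertibility.
\<close>

lemma cis_det_angle:
  fixes V :: "('a::real_or_complex ^ 'n) set"
  assumes "vec.subspace V" "T \<in> GL V"
  shows "cis (det_angle V T) = sgn (to_complex (det_on V T))"
proof -
  have "to_complex (det_on V T) \<noteq> 0"
    using det_on_nonzero[OF assms] inj_eq[OF to_complex_inj, of "det_on V T" 0]
    by (simp add: to_complex_0)
  then show ?thesis by (simp add: det_angle_def cis_Arg)
qed

lemma cis_det_angle_comp:
  fixes V :: "('a::real_or_complex ^ 'n) set"
  assumes "vec.subspace V" "S \<in> GL V" "T \<in> GL V"
  shows "cis (det_angle V (S \<circ> T)) = cis (det_angle V S) * cis (det_angle V T)"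
  using assms by (simp add: cis_det_angle GL_comp det_on_comp to_complex_mult sgn_mult)

lemma GL_pos_iff:
  fixes V :: "('a::real_or_complex ^ 'n) set"
  assumes V: "vec.subspace V" and T: "T \<in> GL V"
  shows "T \<in> GL_pos V \<longleftrightarrow> cis (det_angle V T) = 1"
proof
  assume "T \<in> GL_pos V"
  then obtain r where "r > 0" "det_on V T = of_real r" by (auto simp: GL_pos_def)
  then show "cis (det_angle V T) = 1"
    using assms by (simp add: cis_det_angle to_complex_of_real sgn_of_real)
next
  assume one: "cis (det_angle V T) = 1"
  define z where "z = to_complex (det_on V T)"
  have s: "sgn z = 1" using one by (simp add: cis_det_angle[OF assms] z_def)
  then have "z \<noteq> 0" by auto
  have "z = of_real (cmod z)" using s \<open>z \<noteq> 0\<close> by (simp add: sgn_eq)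
  then have "to_complex (det_on V T) = to_complex (of_real (cmod z))"
    by (simp add: z_def to_complex_of_real)
  then have "det_on V T = of_real (cmod z)" by (rule injD[OF to_complex_inj])
  then show "T \<in> GL_pos V" using T \<open>z \<noteq> 0\<close> by (auto simp: GL_pos_def)
qed

section \<open>Orientations\<close>

text \<open>
  Orientations are the fibres of \<open>T \<mapsto> e\<^sup>i\<^sup>\<phi>\<close>, carried over to bases: \<open>T\<close> and \<open>S\<close> have the same
  phase iff \<open>T \<circ> S\<^sup>-\<^sup>1\<close> is in the kernel \<open>GL\<^sup>+(V)\<close>, and this is the map from \<open>S(\<beta>)\<close> to \<open>T(\<beta>)\<close>.
\<close>

lemma orientation_of_map:
  fixes V :: "('a::real_or_complex ^ 'n) set"
  assumes V: "vec.subspace V" and \<beta>: "ordered_basis V \<beta>" and S: "S \<in> GL V"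
  shows "orientation_of V (map S \<beta>) =
    {map T \<beta> |T. T \<in> GL V \<and> cis (det_angle V T) = cis (det_angle V S)}"
proof (intro Set.set_eqI iffI)
  fix \<gamma> assume "\<gamma> \<in> orientation_of V (map S \<beta>)"
  then obtain R where R: "R \<in> GL_pos V" "\<gamma> = map R (map S \<beta>)"
    by (auto simp: orientation_of_def orientation_rel_def)
  then have GL: "R \<in> GL V" by (simp add: GL_pos_def)
  then have "cis (det_angle V (R \<circ> S)) = cis (det_angle V S)"
    using R GL_pos_iff[OF V GL] by (simp add: cis_det_angle_comp[OF V GL S])
  moreover have "\<gamma> = map (R \<circ> S) \<beta>" using R(2) by simp
  ultimately show "\<gamma> \<in> {map T \<beta> |T. T \<in> GL V \<and> cis (det_angle V T) = cis (det_angle V S)}"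
    using GL_comp[OF GL S] by blast
next
  fix \<gamma> assume "\<gamma> \<in> {map T \<beta> |T. T \<in> GL V \<and> cis (det_angle V T) = cis (det_angle V S)}"
  then obtain T where T: "\<gamma> = map T \<beta>" "T \<in> GL V" "cis (det_angle V T) = cis (det_angle V S)"
    by blast
  obtain S' where S': "S' \<in> GL V" "\<forall>v\<in>V. S' (S v) = v" "\<forall>v\<in>V. S (S' v) = v"
    by (rule GL_inverse[OF V S])
  define R where "R = T \<circ> S'"
  have R: "R \<in> GL V" unfolding R_def by (rule GL_comp[OF T(2) S'(1)])
  have RS: "(R \<circ> S) v = T v" if "v \<in> V" for v using S'(2) that by (simp add: R_def)
  have "det_on V (R \<circ> S) = det_on V T" using RS by (rule det_on_cong[OF V])
  then have "cis (det_angle V R) * cis (det_angle V S) = cis (det_angle V T)"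
    unfolding cis_det_angle_comp[OF V R S, symmetric] by (simp only: det_angle_def)
  then have "R \<in> GL_pos V" using T(3) by (simp add: GL_pos_iff[OF V R])
  moreover have "\<gamma> = map R (map S \<beta>)"
    using RS ordered_basis_nth[OF \<beta>] by (simp add: T(1) list_eq_iff_nth_eq)
  ultimately show "\<gamma> \<in> orientation_of V (map S \<beta>)"
    using ordered_basis_map[OF V S \<beta>] ordered_basis_map[OF V T(2) \<beta>] T(1)
    by (auto simp: orientation_of_def orientation_rel_def)
qed

lemma orientation_of_map_eq_iff:
  fixes V :: "('a::real_or_complex ^ 'n) set"
  assumes V: "vec.subspace V" and \<beta>: "ordered_basis V \<beta>" and S: "S \<in> GL V" and T: "T \<in> GL V"
  shows "orientation_of V (map S \<beta>) = orientation_of V (map T \<beta>) \<longleftrightarrow>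
    cis (det_angle V S) = cis (det_angle V T)"
proof
  assume "orientation_of V (map S \<beta>) = orientation_of V (map T \<beta>)"
  moreover have "map S \<beta> \<in> orientation_of V (map S \<beta>)"
    using S by (auto simp: orientation_of_map[OF V \<beta> S])
  ultimately obtain R where R: "R \<in> GL V" "map S \<beta> = map R \<beta>"
      "cis (det_angle V R) = cis (det_angle V T)"
    by (auto simp: orientation_of_map[OF V \<beta> T])
  have "det_on V S = det_on V R"
    by (rule det_on_cong[OF V]) (rule GL_eq_on_basis[OF V S R(1) \<beta> R(2)])
  then show "cis (det_angle V S) = cis (det_angle V T)" using R(3) by (simp add: det_angle_def)
qed (simp add: orientation_of_map[OF V \<beta>] S T)

lemma orientations_eq:
  assumes V: "vec.subspace V" and \<beta>: "ordered_basis V \<beta>"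
  shows "orientations V = (\<lambda>T. orientation_of V (map T \<beta>)) ` GL V"
proof -
  have "{\<gamma>. ordered_basis V \<gamma>} = (\<lambda>T. map T \<beta>) ` GL V"
  proof (intro Set.set_eqI iffI)
    fix \<gamma> assume "\<gamma> \<in> {\<gamma>. ordered_basis V \<gamma>}"
    then have "ordered_basis V \<gamma>" by simp
    then obtain T where "T \<in> GL V" "map T \<beta> = \<gamma>" by (rule GL_between_bases[OF \<beta>])
    then show "\<gamma> \<in> (\<lambda>T. map T \<beta>) ` GL V" by blast
  qed (auto intro: ordered_basis_map[OF V _ \<beta>])
  then show ?thesis
    by (auto simp: orientations_def orientation_of_def quotient_def)
qed

lemma orientation_number_eq:
  fixes V :: "('a::real_or_complex ^ 'n) set"
  assumes "vec.subspace V" "ordered_basis V \<beta>" "T \<in> GL V"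
  shows "orientation_number V \<beta> (orientation_of V (map T \<beta>)) = cis (det_angle V T)"
  unfolding orientation_number_def
  by (rule the_equality) (use assms orientation_of_map_eq_iff[OF assms(1,2)] in auto)

text \<open>
  With \<open>\<beta>\<close> itself as reference basis the orientation of \<open>\<beta>\<close> is the fibre over \<open>1\<close>. Composition with
  \<open>T\<close> maps it onto the fibre over the phase of \<open>T\<close>, the inverse being composition with \<open>T\<^sup>-\<^sup>1\<close>. So
  \<open>T \<circ> GL\<^sup>+(V) = GL\<^sup>+(V) \<circ> T\<close>: a kernel is normal.
\<close>

lemma act_orientation_of:
  fixes V :: "('a::real_or_complex ^ 'n) set"
  assumes V: "vec.subspace V" and T: "T \<in> GL V" and \<beta>: "ordered_basis V \<beta>"
  shows "act T (orientation_of V \<beta>) = orientation_of V (map T \<beta>)"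
proof -
  have id: "orientation_of V \<beta> = {map R \<beta> |R. R \<in> GL V \<and> cis (det_angle V R) = 1}"
    using orientation_of_map[OF V \<beta> GL_id]
    by (simp add: det_angle_def det_on_id[OF V] to_complex_1)
  obtain T' where T': "T' \<in> GL V" "\<forall>v\<in>V. T' (T v) = v" "\<forall>v\<in>V. T (T' v) = v"
    by (rule GL_inverse[OF V T])
  show ?thesis
  proof (intro Set.set_eqI iffI)
    fix \<gamma> assume "\<gamma> \<in> act T (orientation_of V \<beta>)"
    then obtain R where R: "R \<in> GL V" "cis (det_angle V R) = 1" "\<gamma> = map (T \<circ> R) \<beta>"
      by (auto simp: act_def id)
    then have "cis (det_angle V (T \<circ> R)) = cis (det_angle V T)"
      by (simp add: cis_det_angle_comp[OF V T])
    then show "\<gamma> \<in> orientation_of V (map T \<beta>)"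
      using GL_comp[OF T R(1)] R(3) unfolding orientation_of_map[OF V \<beta> T] by blast
  next
    fix \<gamma> assume "\<gamma> \<in> orientation_of V (map T \<beta>)"
    then obtain R where R: "R \<in> GL V" "cis (det_angle V R) = cis (det_angle V T)" "\<gamma> = map R \<beta>"
      by (auto simp: orientation_of_map[OF V \<beta> T])
    have GL: "T' \<circ> R \<in> GL V" by (rule GL_comp[OF T'(1) R(1)])
    have TTR: "(T \<circ> (T' \<circ> R)) v = R v" if "v \<in> V" for v
      using T'(3) GL_mem[OF R(1) that] by simp
    have "det_on V (T \<circ> (T' \<circ> R)) = det_on V R" using TTR by (rule det_on_cong[OF V])
    then have "cis (det_angle V T) * cis (det_angle V (T' \<circ> R)) = cis (det_angle V R)"
      unfolding cis_det_angle_comp[OF V T GL, symmetric] by (simp only: det_angle_def)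
    then have "cis (det_angle V T) * cis (det_angle V (T' \<circ> R)) = cis (det_angle V T)"
      by (simp only: R(2))
    then have "cis (det_angle V (T' \<circ> R)) = 1" by simp
    then have "map (T' \<circ> R) \<beta> \<in> orientation_of V \<beta>" using GL unfolding id by blast
    moreover have "\<gamma> = map T (map (T' \<circ> R) \<beta>)"
      using TTR ordered_basis_nth[OF \<beta>] by (simp add: R(3) list_eq_iff_nth_eq)
    ultimately show "\<gamma> \<in> act T (orientation_of V \<beta>)" unfolding act_def by blast
  qed
qed

theorem proposition3p2:
  fixes V :: "('a::real_or_complex ^ 'n) set"
    and T :: "'a ^ 'n \<Rightarrow> 'a ^ 'n"
    and \<beta>0 :: "('a ^ 'n) list"
  assumes "vec.subspace V"
    and "T \<in> GL V"
    and "ordered_basis V \<beta>0"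
  shows
    "(\<forall>T0\<in>GL V. orientation_number V \<beta>0 (orientation_of V (map T0 \<beta>0)) = cis (det_angle V T0)) \<and>
     inj_on (orientation_number V \<beta>0) (orientations V) \<and>
     orientation_number V \<beta>0 ` orientations V \<subseteq> unit_circle TYPE('a) \<and>
     (V \<noteq> {0} \<longrightarrow> bij_betw (orientation_number V \<beta>0) (orientations V) (unit_circle TYPE('a))) \<and>
     (\<forall>\<beta>. ordered_basis V \<beta> \<longrightarrow> act T (orientation_of V \<beta>) = orientation_of V (map T \<beta>)) \<and>
     (\<forall>\<omega>\<in>orientations V.
        act T \<omega> \<in> orientations V \<and>
        orientation_number V \<beta>0 (act T \<omega>) = cis (det_angle V T) * orientation_number V \<beta>0 \<omega>)"
proof -
  note V = assms(1) and T = assms(2) and \<beta>0 = assms(3)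
  let ?N = "orientation_number V \<beta>0"
  let ?o = "\<lambda>S. orientation_of V (map S \<beta>0)"
  have N: "?N (?o S) = cis (det_angle V S)" if "S \<in> GL V" for S
    by (rule orientation_number_eq[OF V \<beta>0 that])
  have O: "orientations V = ?o ` GL V" by (rule orientations_eq[OF V \<beta>0])
  have inj: "inj_on ?N (orientations V)"
    unfolding O by (simp add: inj_on_def N orientation_of_map_eq_iff[OF V \<beta>0])
  have sub: "?N ` orientations V \<subseteq> unit_circle TYPE('a)"
  proof -
    have "cis (det_angle V S) \<in> range (to_complex :: 'a \<Rightarrow> complex)" if "S \<in> GL V" for S
    proof -
      let ?d = "det_on V S"
      \<comment> \<open>Normalising \<open>det S\<close> by a real factor can be done inside the field itself.\<close>
      have "cis (det_angle V S) = to_complex (inverse (cmod (to_complex ?d)) *\<^sub>R ?d)"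
        by (simp add: cis_det_angle[OF V that] to_complex_scaleR sgn_div_norm)
      then show ?thesis by (rule range_eqI)
    qed
    then show ?thesis unfolding O by (auto simp: N unit_circle_def)
  qed
  have surj: "unit_circle TYPE('a) \<subseteq> ?N ` orientations V" if V0: "V \<noteq> {0}"
  proof
    fix z assume "z \<in> unit_circle TYPE('a)"
    then obtain c :: 'a where c: "z = to_complex c" "cmod z = 1" by (auto simp: unit_circle_def)
    then have c0: "c \<noteq> 0" by (auto simp: to_complex_0)
    obtain S where S: "S \<in> GL V" "det_on V S = c"
      by (rule det_on_surj[OF V V0 c0])
    then have "z = ?N (?o S)" using c by (simp add: N cis_det_angle[OF V] sgn_div_norm)
    then show "z \<in> ?N ` orientations V" using S(1) unfolding O by blast
  qed
  have act: "act T (orientation_of V \<beta>) = orientation_of V (map T \<beta>)" if "ordered_basis V \<beta>" for \<beta>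
    by (rule act_orientation_of[OF V T that])
  have "act T \<omega> \<in> orientations V \<and> ?N (act T \<omega>) = cis (det_angle V T) * ?N \<omega>"
    if \<omega>: "\<omega> \<in> orientations V" for \<omega>
  proof -
    obtain S where S: "S \<in> GL V" "\<omega> = ?o S" using \<omega> unfolding O by blast
    have "act T \<omega> = ?o (T \<circ> S)" using act[OF ordered_basis_map[OF V S(1) \<beta>0]] by (simp add: S(2))
    then show ?thesis
      using GL_comp[OF T S(1)] cis_det_angle_comp[OF V T S(1)] S by (auto simp: N O)
  qed
  then show ?thesis using N inj sub surj act by (auto simp: bij_betw_def)
qed

end
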